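(* Let $(\mathcal{A},d)$ be a metric space, let $Q:\mathcal{A}\to\mathbb{R}$ be a function with $Q^*:=\sup_{A\in\mathcal{A}}Q(A)<\infty$, let $C:\mathcal{A}\to\mathcal{A}$ be a map, and let $T\subset\mathcal{A}$ be a nonempty finite set. For $a\in\mathcal{A}$ put $\rho(a)=\min_{A\in T}d(a,A)$. Let $\beta\in(0,1)$, $L_Q>0$, $L_C>0$ be constants such that: (i) for all $A\in T$, $Q(C(A))-Q(A)\ge \beta\,[Q^*-Q(A)]$; (ii) for all $A^{(1)},A^{(2)}\in\mathcal{A}$, $|Q(A^{(1)})-Q(A^{(2)})|\le L_Q\,d(A^{(1)},A^{(2)})$; (iii) for all $A^{(1)},A^{(2)}\in\mathcal{A}$, $d(C(A^{(1)}),C(A^{(2)}))\le L_C\,d(A^{(1)},A^{(2)})$. Let $A_0\in\mathcal{A}$, $\rho_0=\rho(A_0)$ and $A_1=C(A_0)$. Then $$Q(A_1)\ \ge\ \beta\,Q^*+(1-\beta)\,Q(A_0)-\rho_0\,L_Q\,(1-\beta+L_C).$$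
   Context: Interpretation (not needed for the mathematics): for a fixed visual input $V$ and language input $L$, $\mathcal{A}$ is the space of actions (trajectories), $Q(A)=Q(V,L,A)$ is the value of action $A$, $C(A)=c(V,L,A)$ is the refined action output by a critic model, $T$ is the set of actions occurring in the critic's training set, $Q^*=Q^*(V,L)$ is the optimal value, and $A_0$ is the initial action. Hypothesis (i) is the "critic improvement" assumption on the training set, and (ii)–(iii) are the "Lipschitz continuity" assumptions on the value function and on the critic. *)

theory Defs
  imports Complex_Main
begin

end

theory Submission
  imports Defs
begin

text \<open>Compare \<open>A\<^sub>0\<close> with a nearest training action \<open>A\<close>. Critic
  improvement at \<open>A\<close>, rearranged, bounds \<open>Q (C A)\<close> below by a convex
  combination of the optimal value and \<open>Q A\<close>. Transferring this to
  \<open>A\<^sub>0\<close> costs twice: replacing \<open>Q A\<close> loses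
  \<open>L\<^sub>Q * r\<close>, damped by the weight \<open>1 - \<beta>\<close>, and replacing
  \<open>Q (C A)\<close> loses \<open>L\<^sub>Q * L\<^sub>C * r\<close>. The two losses add up to
  the error term.\<close>

theorem theorem3p3:
  fixes Q :: "'a::metric_space \<Rightarrow> real"
    and C :: "'a \<Rightarrow> 'a"
    and T :: "'a set"
    and \<beta> L\<^sub>Q L\<^sub>C :: real
    and A\<^sub>0 :: 'a
  assumes Q_bdd: "bdd_above (range Q)"
    and T_fin: "finite T"
    and T_ne: "T \<noteq> {}"
    and beta: "0 < \<beta>" "\<beta> < 1"
    and LQ_pos: "L\<^sub>Q > 0"
    and LC_pos: "L\<^sub>C > 0"
    and critic_improvement: "\<forall>A\<in>T. Q (C A) - Q A \<ge> \<beta> * ((SUP B. Q B) - Q A)"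
    and Q_lipschitz: "\<forall>A B. \<bar>Q A - Q B\<bar> \<le> L\<^sub>Q * dist A B"
    and C_lipschitz: "\<forall>A B. dist (C A) (C B) \<le> L\<^sub>C * dist A B"
  shows "Q (C A\<^sub>0) \<ge> \<beta> * (SUP B. Q B) + (1 - \<beta>) * Q A\<^sub>0
           - (MIN A\<in>T. dist A\<^sub>0 A) * L\<^sub>Q * (1 - \<beta> + L\<^sub>C)"
proof -
  define S where "S = (SUP B. Q B)"
  define r where "r = (MIN A\<in>T. dist A\<^sub>0 A)"
  \<comment> \<open>The minimum over a finite nonempty set is attained, so \<open>r\<close> is the
    distance to an actual element of \<open>T\<close>, where critic improvement applies.\<close>
  have "r \<in> dist A\<^sub>0 ` T"
    unfolding r_def using T_fin T_ne by (intro Min_in) auto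
  then obtain A where "A \<in> T" and r: "r = dist A\<^sub>0 A" by blast
  have improvement: "Q (C A) \<ge> \<beta> * S + (1 - \<beta>) * Q A"
    using critic_improvement \<open>A \<in> T\<close> by (auto simp: S_def algebra_simps)
  have "Q A \<ge> Q A\<^sub>0 - L\<^sub>Q * r"
    using Q_lipschitz[rule_format, of A\<^sub>0 A] by (simp add: r abs_le_iff)
  \<comment> \<open>Since \<open>\<beta> < 1\<close>, the weight is positive and keeps the direction
    of the inequality.\<close>
  then have start: "(1 - \<beta>) * Q A \<ge> (1 - \<beta>) * (Q A\<^sub>0 - L\<^sub>Q * r)"
    using beta by (intro mult_left_mono) auto
  \<comment> \<open>The composite of \<open>Q\<close> and \<open>C\<close> is Lipschitz with
    constant \<open>L\<^sub>Q * L\<^sub>C\<close>.\<close>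
  have "\<bar>Q (C A\<^sub>0) - Q (C A)\<bar> \<le> L\<^sub>Q * dist (C A\<^sub>0) (C A)"
    using Q_lipschitz by blast
  also have "\<dots> \<le> L\<^sub>Q * (L\<^sub>C * r)"
    using C_lipschitz LQ_pos by (simp add: r)
  finally have "Q (C A\<^sub>0) \<ge> Q (C A) - L\<^sub>Q * (L\<^sub>C * r)"
    by linarith
  with improvement start
  have "Q (C A\<^sub>0) \<ge> \<beta> * S + (1 - \<beta>) * (Q A\<^sub>0 - L\<^sub>Q * r) - L\<^sub>Q * (L\<^sub>C * r)"
    by linarith
  also have "\<beta> * S + (1 - \<beta>) * (Q A\<^sub>0 - L\<^sub>Q * r) - L\<^sub>Q * (L\<^sub>C * r)
      = \<beta> * S + (1 - \<beta>) * Q A\<^sub>0 - r * L\<^sub>Q * (1 - \<beta> + L\<^sub>C)"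
    by (simp add: algebra_simps)
  finally show ?thesis
    by (simp add: S_def r_def)
qed

end
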